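(* Let $G$ be a strongly connected digraph. Then $G$ has the Riemann--Roch property if and only if both of the following hold: every minimally non-terminating chip-distribution on $G$ has degree $\mathrm{dist}(\mathbf{0}_G)$, and there exists a chip-distribution $C\in\mathbb{Z}^{V(G)}$ such that for every minimally non-terminating distribution $x\in\mathbb{Z}^{V(G)}$, $C-x$ is also minimally non-terminating. Moreover, if this condition holds (with a distribution $C$), then the Riemann--Roch formula holds for $G$ with $C$ as canonical distribution.
   Context: A digraph is a finite directed graph, possibly with multiple edges but without loops. $G$ is strongly connected if for every pair of vertices $u,v$ there are directed paths from $u$ to $v$ and from $v$ to $u$. $\overrightarrow{d}(u,v)$ is the number of directed edges from $u$ to $v$ and $d^+(v)$ is the outdegree of $v$ (with multiplicity). The Laplacian $L\in\mathbb{Z}^{V(G)\times V(G)}$ is given by $L(u,u)=-d^+(u)$ and $L(u,v)=\overrightarrow{d}(v,u)$ for $u\neq v$. $\mathbf{0}_G$ is the zero vector, $\mathbf{1}_v$ the characteristic vector of $v$; $\deg(x)=\sum_{v\in V(G)} x(v)$; inequalities between vectors are coordinatewise. A chip-distribution is an element $x\in\mathbb{Z}^{V(G)}$ (negative entries allowed). Firing $v$ replaces $x$ by $x+L\mathbf{1}_v$. A vertex $v$ is active with respect to $x$ if $x(v)\geq d^+(v)$, and firing $v$ is legal if $v$ is active before the firing. A legal game is a sequence of distributions each obtained from the previous one by a legal firing; it terminates when it reaches a distribution with no active vertex. $x$ is terminating if every legal game started from $x$ terminates, and non-terminating if every legal game started from $x$ can be continued indefinitely; by a theorem of Björner and Lovász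 each $x$ is exactly one of these. $x$ is minimally non-terminating if it is non-terminating but $x-\mathbf{1}_v$ is terminating for each $v\in V(G)$. Define $$\mathrm{dist}(x)=\min\{\deg(y): y\in\mathbb{Z}^{V(G)},\ y\geq\mathbf{0}_G,\ x+y\text{ is non-terminating}\}.$$ A strongly connected digraph $G$ has the Riemann--Roch property if there exist $C\in\mathbb{Z}^{V(G)}$ and an integer $t$ such that the Riemann--Roch formula $\mathrm{dist}(x)-\mathrm{dist}(C-x)=t-\deg(x)$ holds for every $x\in\mathbb{Z}^{V(G)}$; in this case $C$ is called a canonical distribution for $G$. *)

theory Defs
  imports "Graph_Theory.Graph_Theory" "HOL-Library.Function_Algebras"
    "HOL-Library.Indicator_Function"
begin

text \<open>
  Vectors indexed by the vertices are functions of type \<open>'a \<Rightarrow> int\<close> that vanish outside the vertex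
  set, so that each vector has exactly one representative and the pointwise operations and
  order on functions are the coordinatewise ones.
\<close>

definition chip_distributions :: "('a, 'b) pre_digraph \<Rightarrow> ('a \<Rightarrow> int) set" where
  "chip_distributions G = {x. \<forall>v. v \<notin> verts G \<longrightarrow> x v = 0}"

definition chip_degree :: "('a, 'b) pre_digraph \<Rightarrow> ('a \<Rightarrow> int) \<Rightarrow> int" where
  "chip_degree G x = (\<Sum>v\<in>verts G. x v)"

definition edge_count :: "('a, 'b) pre_digraph \<Rightarrow> 'a \<Rightarrow> 'a \<Rightarrow> nat" where
  "edge_count G u v = card (out_arcs G u \<inter> in_arcs G v)"

definition laplacian :: "('a, 'b) pre_digraph \<Rightarrow> 'a \<Rightarrow> 'a \<Rightarrow> int" where
  "laplacian G u v = (if u = v then - int (out_degree G u) else int (edge_count G v u))"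

definition laplacian_mult :: "('a, 'b) pre_digraph \<Rightarrow> ('a \<Rightarrow> int) \<Rightarrow> 'a \<Rightarrow> int" where
  "laplacian_mult G y u = (\<Sum>w\<in>verts G. laplacian G u w * y w)"

definition fire :: "('a, 'b) pre_digraph \<Rightarrow> 'a \<Rightarrow> ('a \<Rightarrow> int) \<Rightarrow> 'a \<Rightarrow> int" where
  "fire G v x = x + laplacian_mult G (indicator {v})"

definition active :: "('a, 'b) pre_digraph \<Rightarrow> ('a \<Rightarrow> int) \<Rightarrow> 'a \<Rightarrow> bool" where
  "active G x v \<longleftrightarrow> v \<in> verts G \<and> x v \<ge> int (out_degree G v)"

definition legal_firing :: "('a, 'b) pre_digraph \<Rightarrow> ('a \<Rightarrow> int) \<Rightarrow> ('a \<Rightarrow> int) \<Rightarrow> bool" where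
  "legal_firing G x x' \<longleftrightarrow> (\<exists>v. active G x v \<and> x' = fire G v x)"

definition finite_legal_game :: "('a, 'b) pre_digraph \<Rightarrow> ('a \<Rightarrow> int) list \<Rightarrow> bool" where
  "finite_legal_game G xs \<longleftrightarrow> xs \<noteq> [] \<and> successively (legal_firing G) xs"

definition infinite_legal_game :: "('a, 'b) pre_digraph \<Rightarrow> (nat \<Rightarrow> 'a \<Rightarrow> int) \<Rightarrow> bool" where
  "infinite_legal_game G f \<longleftrightarrow> (\<forall>i. legal_firing G (f i) (f (Suc i)))"

text \<open>
  A legal game that cannot be prolonged either is infinite or ends in a distribution without
  active vertices. Hence every legal game from \<open>x\<close> terminates iff no infinite one starts at \<open>x\<close>.
  Non-termination is not defined as the negation of this: it asks that every finite legal game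
  from \<open>x\<close> be a prefix of an infinite one.
\<close>

definition terminating :: "('a, 'b) pre_digraph \<Rightarrow> ('a \<Rightarrow> int) \<Rightarrow> bool" where
  "terminating G x \<longleftrightarrow> \<not> (\<exists>f. infinite_legal_game G f \<and> f 0 = x)"

definition non_terminating :: "('a, 'b) pre_digraph \<Rightarrow> ('a \<Rightarrow> int) \<Rightarrow> bool" where
  "non_terminating G x \<longleftrightarrow>
    (\<forall>xs. finite_legal_game G xs \<and> hd xs = x \<longrightarrow>
      (\<exists>f. infinite_legal_game G f \<and> (\<forall>i<length xs. f i = xs ! i)))"

definition minimally_non_terminating :: "('a, 'b) pre_digraph \<Rightarrow> ('a \<Rightarrow> int) \<Rightarrow> bool" where
  "minimally_non_terminating G x \<longleftrightarrow>
    non_terminating G x \<and> (\<forall>v\<in>verts G. terminating G (x - indicator {v}))"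

definition nonterm_dist :: "('a, 'b) pre_digraph \<Rightarrow> ('a \<Rightarrow> int) \<Rightarrow> int" where
  "nonterm_dist G x =
    (LEAST n. \<exists>y\<in>chip_distributions G. y \<ge> 0 \<and> non_terminating G (x + y) \<and> n = chip_degree G y)"

definition riemann_roch_formula ::
    "('a, 'b) pre_digraph \<Rightarrow> ('a \<Rightarrow> int) \<Rightarrow> int \<Rightarrow> bool" where
  "riemann_roch_formula G C t \<longleftrightarrow>
    (\<forall>x\<in>chip_distributions G. nonterm_dist G x - nonterm_dist G (C - x) = t - chip_degree G x)"

definition canonical_distribution :: "('a, 'b) pre_digraph \<Rightarrow> ('a \<Rightarrow> int) \<Rightarrow> bool" where
  "canonical_distribution G C \<longleftrightarrow> C \<in> chip_distributions G \<and> (\<exists>t. riemann_roch_formula G C t)"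

definition riemann_roch_property :: "('a, 'b) pre_digraph \<Rightarrow> bool" where
  "riemann_roch_property G \<longleftrightarrow> (\<exists>C. canonical_distribution G C)"

end

theory Submission
  imports Defs
begin

text \<open>
  The combinatorial input is that of Bjorner and Lovasz: if some legal game from \<open>x\<close> is infinite,
  then firing any active vertex leaves a distribution that again has an infinite game
  (\<open>not_terminating_fire\<close>). So non-terminating is the negation of terminating, and it is preserved
  by adding chips. Moreover, strong connectivity forces every vertex to fire infinitely often in an
  infinite game, and a vertex is never in debt after its first legal firing; so a non-terminating
  distribution can be played, without changing its degree, to a nonnegative non-terminating one
  (\<open>non_terminating_nonneg_representative\<close>). In particular its degree is nonnegative, whence
  removing chips one at a time reaches a minimally non-terminating distribution below it.

  Write \<open>M\<close> for the set of minimally non-terminating distributions.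

  Suppose the Riemann--Roch formula holds and \<open>x \<in> M\<close>. Then \<open>x\<close> has distance 0 and each
  \<open>x - 1\<^sub>v\<close> has distance 1, and the formula turns this into the statement that adding a chip
  anywhere to \<open>C - x\<close> does not lower its distance. A positive distance could be lowered by one of
  the chips of an optimal \<open>y\<close>, so the distance of \<open>C - x\<close> is 0. The formula at \<open>x\<close> then reads
  \<open>deg x = t\<close>, and at \<open>x + 1\<^sub>v\<close> it says that \<open>C - x - 1\<^sub>v\<close> has distance 1; so
  \<open>C - x \<in> M\<close>. The nonnegative representatives identify the common degree \<open>t\<close> with
  the distance of the zero distribution.

  Conversely, let all elements of \<open>M\<close> have degree \<open>k\<close> and let \<open>z \<mapsto> C - z\<close> preserve \<open>M\<close>. Choose an
  optimal \<open>y\<close> for \<open>x\<close> and \<open>z \<in> M\<close> with \<open>z \<le> x + y\<close>. The nonnegative distribution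
  \<open>x + y - z\<close> carries \<open>C - x\<close> to \<open>(C - z) + y\<close>, which is non-terminating, and this gives
  \<open>dist (C - x) \<le> dist x - k + deg x\<close>. Since \<open>deg C = 2 * k\<close>, the same inequality at \<open>C - x\<close> is the
  reverse one, so the two together are the Riemann--Roch formula.
\<close>


section \<open>Firing and the degree\<close>

locale chip_firing_graph = fin_digraph G + loopfree_digraph G for G :: "('a, 'b) pre_digraph" +
  assumes strongly_connected: "strongly_connected G"
begin

lemma fire_apply:
  assumes "v \<in> verts G"
  shows "fire G v x u = x u + laplacian G u v"
proof -
  have "laplacian_mult G (indicator {v}) u
      = (\<Sum>w\<in>verts G. if w = v then laplacian G u w else 0)"
    unfolding laplacian_mult_def by (intro sum.cong) (auto simp: indicator_def)
  then show ?thesis using assms by (simp add: fire_def)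
qed

lemma fire_commute: "fire G v (fire G w x) = fire G w (fire G v x)"
  by (simp add: fire_def algebra_simps)

lemma fire_add: "fire G v (x + y) = fire G v x + y"
  by (simp add: fire_def algebra_simps)

lemma fire_self: "v \<in> verts G \<Longrightarrow> fire G v x v = x v - int (out_degree G v)"
  by (simp add: fire_apply laplacian_def)

lemma fire_other: "v \<in> verts G \<Longrightarrow> u \<noteq> v \<Longrightarrow> fire G v x u = x u + int (edge_count G v u)"
  by (simp add: fire_apply laplacian_def)

lemma edge_count_pos: "e \<in> arcs G \<Longrightarrow> edge_count G (tail G e) (head G e) > 0"
  unfolding edge_count_def by (subst card_gt_0_iff) auto

lemma sum_edge_count: "(\<Sum>u\<in>verts G. edge_count G v u) = out_degree G v"
proof -
  have "out_arcs G v = (\<Union>u\<in>verts G. out_arcs G v \<inter> in_arcs G u)"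
    by auto
  also have "card \<dots> = (\<Sum>u\<in>verts G. edge_count G v u)"
    unfolding edge_count_def by (intro card_UN_disjoint) auto
  finally show ?thesis by (simp add: out_degree_def)
qed

lemma edge_count_self: "edge_count G v v = 0"
proof -
  have "out_arcs G v \<inter> in_arcs G v = {}" using no_loops by force
  then show ?thesis by (simp add: edge_count_def)
qed

lemma chip_degree_add: "chip_degree G (x + y) = chip_degree G x + chip_degree G y"
  by (simp add: chip_degree_def sum.distrib)

lemma chip_degree_diff: "chip_degree G (x - y) = chip_degree G x - chip_degree G y"
  by (simp add: chip_degree_def sum_subtractf)

lemma chip_degree_indicator: "v \<in> verts G \<Longrightarrow> chip_degree G (indicator {v}) = 1"
  by (simp add: chip_degree_def indicator_def)

lemma chip_degree_nonneg: "y \<ge> 0 \<Longrightarrow> chip_degree G y \<ge> 0"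
  by (simp add: chip_degree_def le_fun_def sum_nonneg)

lemma chip_degree_fire:
  assumes "v \<in> verts G"
  shows "chip_degree G (fire G v x) = chip_degree G x"
proof -
  have "(\<Sum>u\<in>verts G. laplacian G u v)
      = (\<Sum>u\<in>verts G. int (edge_count G v u) - (if u = v then int (out_degree G v) else 0))"
    by (intro sum.cong) (auto simp: laplacian_def edge_count_self)
  also have "\<dots> = int (\<Sum>u\<in>verts G. edge_count G v u) - int (out_degree G v)"
    using assms by (simp add: sum_subtractf)
  finally show ?thesis
    using assms by (simp add: chip_degree_def fire_apply sum.distrib sum_edge_count)
qed

lemma chip_distributions_fire:
  assumes "v \<in> verts G" "x \<in> chip_distributions G"
  shows "fire G v x \<in> chip_distributions G"
proof -
  have "edge_count G v u = 0" if "u \<notin> verts G" for u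
  proof -
    have "out_arcs G v \<inter> in_arcs G u = {}" using that by auto
    then show ?thesis by (simp add: edge_count_def)
  qed
  then show ?thesis using assms by (auto simp: chip_distributions_def fire_apply laplacian_def)
qed

lemma chip_distributions_add:
  "x \<in> chip_distributions G \<Longrightarrow> y \<in> chip_distributions G \<Longrightarrow> x + y \<in> chip_distributions G"
  by (simp add: chip_distributions_def)

lemma chip_distributions_diff:
  "x \<in> chip_distributions G \<Longrightarrow> y \<in> chip_distributions G \<Longrightarrow> x - y \<in> chip_distributions G"
  by (simp add: chip_distributions_def)

lemma chip_distributions_indicator: "v \<in> verts G \<Longrightarrow> indicator {v} \<in> chip_distributions G"
  by (auto simp: chip_distributions_def indicator_def)

lemma chip_distributions_zero: "0 \<in> chip_distributions G"
  by (simp add: chip_distributions_def)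

lemmas chip_distributions_closed = chip_distributions_add chip_distributions_diff
  chip_distributions_indicator chip_distributions_zero


section \<open>Termination does not depend on the choice of legal moves\<close>

text \<open>
  Having an infinite game is a coinductive property: a set that can always be continued by a legal
  move suffices, so that no infinite sequence has to be rearranged explicitly.
\<close>

lemma not_terminating_coinduct:
  assumes "x \<in> S" and "\<And>y. y \<in> S \<Longrightarrow> \<exists>y'\<in>S. legal_firing G y y'"
  shows "\<not> terminating G x"
proof -
  have "\<exists>f. \<forall>i. (f i \<in> S \<and> (i = 0 \<longrightarrow> f i = x)) \<and> legal_firing G (f i) (f (Suc i))"
    by (rule dependent_nat_choice) (use assms in auto)
  then show ?thesis by (auto simp: terminating_def infinite_legal_game_def)
qed

lemma infinite_legal_game_not_terminating:
  assumes "infinite_legal_game G f"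
  shows "\<not> terminating G (f i)"
  using assms by (intro not_terminating_coinduct[where S = "range f"]) (auto simp: infinite_legal_game_def)

lemma not_terminating_step:
  assumes "\<not> terminating G x"
  obtains v where "active G x v" "\<not> terminating G (fire G v x)"
proof -
  from assms obtain f where f: "infinite_legal_game G f" "f 0 = x" by (auto simp: terminating_def)
  then obtain v where "active G x v" "f 1 = fire G v x"
    unfolding infinite_legal_game_def legal_firing_def by (metis One_nat_def)
  then show ?thesis using infinite_legal_game_not_terminating[OF f(1), of 1] that by simp
qed

lemma active_fire_other:
  assumes "active G x v" "w \<in> verts G" "w \<noteq> v"
  shows "active G (fire G w x) v"
  using assms by (auto simp: active_def fire_other)

text \<open>
  This is the exchange argument of Bjorner and Lovasz. Given an infinite game from \<open>x\<close>, move its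
  first firing of \<open>w\<close> (if there is one) to the front: until then \<open>w\<close> only gains chips, and the other
  vertices only profit from the early firing. In coinductive form the invariant is that either
  \<open>w\<close> is still owed, or it has been fired and the two games coincide.
\<close>

lemma not_terminating_fire:
  assumes "\<not> terminating G x" "active G x w"
  shows "\<not> terminating G (fire G w x)"
proof -
  let ?N = "{z. \<not> terminating G z}" and ?O = "{fire G w z | z. \<not> terminating G z \<and> active G z w}"
  have w: "w \<in> verts G" using assms by (simp add: active_def)
  have old: "\<exists>y'\<in>?N. legal_firing G y y'" if "\<not> terminating G y" for y
    by (rule not_terminating_step[OF that]) (auto simp: legal_firing_def)
  show ?thesis
  proof (rule not_terminating_coinduct[where S = "?N \<union> ?O"])
    fix y assume "y \<in> ?N \<union> ?O"
    then consider "\<not> terminating G y"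
      | z where "y = fire G w z" "\<not> terminating G z" "active G z w" by auto
    then show "\<exists>y'\<in>?N \<union> ?O. legal_firing G y y'"
    proof cases
      case 1
      then show ?thesis using old by blast
    next
      case 2
      obtain v where v: "active G z v" "\<not> terminating G (fire G v z)"
        using not_terminating_step[OF 2(2)] .
      show ?thesis
      proof (cases "v = w")
        case True
        then show ?thesis using old v(2) 2(1) by blast
      next
        case False
        have "v \<in> verts G" using v(1) by (simp add: active_def)
        then have "active G (fire G v z) w" using 2(3) False active_fire_other by blast
        then have "fire G w (fire G v z) \<in> ?O" using v(2) by blast
        moreover have "legal_firing G y (fire G w (fire G v z))"
          using active_fire_other[OF v(1) w] False 2(1)
          by (auto simp: legal_firing_def fire_commute[of w v])
        ultimately show ?thesis by blast
      qed
    qed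
  qed (use assms in blast)
qed

lemma not_terminating_finite_game:
  assumes "finite_legal_game G xs" "\<not> terminating G (hd xs)" "i < length xs"
  shows "\<not> terminating G (xs ! i)"
  using assms(3)
proof (induction i)
  case 0
  then show ?case using assms by (simp add: hd_conv_nth finite_legal_game_def)
next
  case (Suc i)
  have "legal_firing G (xs ! i) (xs ! Suc i)"
    using assms(1) Suc.prems by (simp add: finite_legal_game_def successively_conv_nth)
  then show ?case using Suc not_terminating_fire by (auto simp: legal_firing_def)
qed

text \<open>
  The dichotomy of terminating and non-terminating: by the exchange argument a finite game cannot
  leave the set of distributions with an infinite game, so an infinite game can be spliced onto its
  last distribution.
\<close>

lemma non_terminating_iff: "non_terminating G x \<longleftrightarrow> \<not> terminating G x"
proof
  assume "non_terminating G x"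
  then have "\<exists>f. infinite_legal_game G f \<and> (\<forall>i<length [x]. f i = [x] ! i)"
    unfolding non_terminating_def by (elim allE[of _ "[x]"]) (simp add: finite_legal_game_def)
  then show "\<not> terminating G x" by (auto simp: terminating_def)
next
  assume nt: "\<not> terminating G x"
  show "non_terminating G x"
    unfolding non_terminating_def
  proof (intro allI impI, elim conjE)
    fix xs assume xs: "finite_legal_game G xs" "hd xs = x"
    let ?n = "length xs - 1"
    have ne: "xs \<noteq> []" using xs by (simp add: finite_legal_game_def)
    then have "\<not> terminating G (xs ! ?n)" using xs nt by (intro not_terminating_finite_game) auto
    then obtain f where f: "infinite_legal_game G f" "f 0 = xs ! ?n" by (auto simp: terminating_def)
    define g where "g i = (if i < ?n then xs ! i else f (i - ?n))" for i
    have "legal_firing G (g i) (g (Suc i))" for i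
    proof (cases "i < ?n")
      case True
      then have "g (Suc i) = xs ! Suc i" using f(2) by (cases "Suc i = ?n") (auto simp: g_def)
      then show ?thesis using True xs(1)
        by (auto simp: g_def finite_legal_game_def successively_conv_nth)
    next
      case False
      then show ?thesis using f(1) by (auto simp: g_def infinite_legal_game_def Suc_diff_le)
    qed
    moreover have "g i = xs ! i" if "i < length xs" for i
      using that f(2) ne by (cases "i = ?n") (auto simp: g_def)
    ultimately show "\<exists>f. infinite_legal_game G f \<and> (\<forall>i<length xs. f i = xs ! i)"
      by (auto simp: infinite_legal_game_def)
  qed
qed

text \<open>A game stays legal when chips are added that are never moved.\<close>

lemma non_terminating_add:
  assumes "non_terminating G x" "y \<ge> 0"
  shows "non_terminating G (x + y)"
  unfolding non_terminating_iff
proof (rule not_terminating_coinduct[where S = "{z + y | z. \<not> terminating G z}"])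
  fix u assume "u \<in> {z + y | z. \<not> terminating G z}"
  then obtain z where z: "u = z + y" "\<not> terminating G z" by blast
  obtain v where v: "active G z v" "\<not> terminating G (fire G v z)"
    using not_terminating_step[OF z(2)] .
  have "0 \<le> y v" using assms(2) by (simp add: le_fun_def)
  then have "active G u v" using v(1) z(1) by (auto simp: active_def)
  then have "legal_firing G u (fire G v z + y)" using z(1) by (auto simp: legal_firing_def fire_add)
  then show "\<exists>u'\<in>{z + y | z. \<not> terminating G z}. legal_firing G u u'" using v(2) by blast
qed (use assms(1) in \<open>auto simp: non_terminating_iff\<close>)

text \<open>By the pigeonhole principle such a distribution has an active vertex, and firing preserves
  the degree.\<close>

lemma non_terminating_of_large_degree:
  assumes "chip_degree G x \<ge> (\<Sum>v\<in>verts G. int (out_degree G v))"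
  shows "non_terminating G x"
  unfolding non_terminating_iff
proof (rule not_terminating_coinduct
    [where S = "{x. chip_degree G x \<ge> (\<Sum>v\<in>verts G. int (out_degree G v))}"])
  fix y assume "y \<in> {x. chip_degree G x \<ge> (\<Sum>v\<in>verts G. int (out_degree G v))}"
  then have y: "(\<Sum>v\<in>verts G. y v) \<ge> (\<Sum>v\<in>verts G. int (out_degree G v))"
    by (simp add: chip_degree_def)
  have "\<exists>v. active G y v"
  proof (rule ccontr)
    assume "\<nexists>v. active G y v"
    then have "(\<Sum>v\<in>verts G. y v) < (\<Sum>v\<in>verts G. int (out_degree G v))"
      using strongly_connected by (intro sum_strict_mono) (auto simp: active_def strongly_connected_def)
    then show False using y by simp
  qed
  then obtain v where "active G y v" ..
  then show "\<exists>y'\<in>{x. chip_degree G x \<ge> (\<Sum>v\<in>verts G. int (out_degree G v))}. legal_firing G y y'"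
    using y by (intro bexI[of _ "fire G v y"])
      (auto simp: legal_firing_def active_def chip_degree_fire, simp add: chip_degree_def)
qed (use assms in simp)


section \<open>In an infinite game the debts disappear\<close>

text \<open>An infinite legal game \<open>f\<close> together with a record \<open>s\<close> of the vertices fired.\<close>

context
  fixes f :: "nat \<Rightarrow> 'a \<Rightarrow> int" and s :: "nat \<Rightarrow> 'a"
  assumes act: "\<And>i. active G (f i) (s i)"
    and step: "\<And>i. f (Suc i) = fire G (s i) (f i)"
begin

lemma game_fired_vert: "s i \<in> verts G"
  using act[of i] by (simp add: active_def)

lemma game_mono_step: "s i \<noteq> v \<Longrightarrow> f i v \<le> f (Suc i) v"
  by (simp add: step fire_other game_fired_vert)

lemma game_fired_nonneg: "f (Suc i) (s i) \<ge> 0"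
  using act[of i] by (simp add: step fire_self game_fired_vert active_def)

lemma game_lower_bound_step: "min 0 (f i v) \<le> f (Suc i) v"
  using game_mono_step[of i v] game_fired_nonneg[of i] by (cases "s i = v") auto

lemma game_lower_bound: "i \<le> j \<Longrightarrow> min 0 (f i v) \<le> f j v"
proof (induction j rule: dec_induct)
  case (step j)
  then show ?case using game_lower_bound_step[of j v] by linarith
qed simp

lemma game_degree: "chip_degree G (f i) = chip_degree G (f 0)"
  by (induction i) (simp_all add: step chip_degree_fire game_fired_vert)

lemma game_upper_bound:
  assumes "v \<in> verts G"
  shows "f i v \<le> chip_degree G (f 0) - (\<Sum>u\<in>verts G - {v}. min 0 (f 0 u))"
proof -
  have "chip_degree G (f 0) = f i v + (\<Sum>u\<in>verts G - {v}. f i u)"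
    using assms game_degree[of i] by (simp add: chip_degree_def sum.remove)
  moreover have "(\<Sum>u\<in>verts G - {v}. min 0 (f 0 u)) \<le> (\<Sum>u\<in>verts G - {v}. f i u)"
    by (intro sum_mono game_lower_bound) simp
  ultimately show ?thesis by linarith
qed

text \<open>
  If \<open>v\<close> stopped firing, the infinitely many firings of \<open>u\<close> would pile up chips on it, whereas its
  content is bounded because the degree is constant and no vertex falls below its initial debt.
\<close>

lemma game_fires_successor:
  assumes u: "\<exists>\<^sub>\<infinity>i. s i = u" and e: "e \<in> arcs G" "tail G e = u" "head G e = v"
  shows "\<exists>\<^sub>\<infinity>i. s i = v"
proof (rule ccontr)
  assume "\<not> (\<exists>\<^sub>\<infinity>i. s i = v)"
  then obtain N where N: "\<And>i. i \<ge> N \<Longrightarrow> s i \<noteq> v"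
    by (auto simp: INFM_nat_le)
  have v: "v \<in> verts G" using e by auto
  have uv: "u \<noteq> v" using e no_loops by auto
  have mono: "f i v \<le> f j v" if "N \<le> i" "i \<le> j" for i j
    using that(2)
  proof (induction j rule: dec_induct)
    case (step j)
    then show ?case using game_mono_step[of j v] N[of j] that(1) by simp
  qed simp
  have "\<exists>i\<ge>N. f i v \<ge> f N v + int k" for k
  proof (induction k)
    case (Suc k)
    then obtain i where i: "i \<ge> N" "f i v \<ge> f N v + int k" by blast
    obtain j where j: "j \<ge> i" "s j = u" using u by (auto simp: INFM_nat_le)
    have "f (Suc j) v \<ge> f j v + 1"
      using edge_count_pos[OF e(1)] e j(2) uv game_fired_vert[of j] by (simp add: step fire_other)
    then have "f (Suc j) v \<ge> f N v + int (Suc k)" using mono[OF i(1) j(1)] i(2) by simp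
    then show ?case using i j by (intro exI[of _ "Suc j"]) auto
  qed auto
  from this[of "nat (chip_degree G (f 0) - (\<Sum>u\<in>verts G - {v}. min 0 (f 0 u)) - f N v + 1)"]
  obtain i where "f i v \<ge> f N v
      + int (nat (chip_degree G (f 0) - (\<Sum>u\<in>verts G - {v}. min 0 (f 0 u)) - f N v + 1))"
    by blast
  then show False using game_upper_bound[OF v, of i] by linarith
qed

lemma game_fires_everywhere:
  assumes "v \<in> verts G"
  shows "\<exists>\<^sub>\<infinity>i. s i = v"
proof -
  have "finite (range s)" using game_fired_vert by (intro finite_subset[OF _ finite_verts]) auto
  then obtain k where "infinite {i. s i = s k}"
    using pigeonhole_infinite[of UNIV s] by auto
  then have start: "\<exists>\<^sub>\<infinity>i. s i = s k" by (simp add: frequently_cofinite)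
  have "s k \<rightarrow>\<^sup>*\<^bsub>G\<^esub> v"
    using strongly_connected assms game_fired_vert by (simp add: strongly_connected_def)
  then show ?thesis
    using start
  proof (induction rule: reachable_induct)
    case (step u w)
    then obtain e where "e \<in> arcs G" "tail G e = u" "head G e = w" by auto
    then show ?case using step.IH step.prems game_fires_successor by blast
  qed
qed

lemma game_eventually_nonneg: "\<exists>n. \<forall>v\<in>verts G. f n v \<ge> 0"
proof -
  have "\<forall>\<^sub>F n in sequentially. f n v \<ge> 0" if v: "v \<in> verts G" for v
  proof -
    obtain i where i: "s i = v" using game_fires_everywhere[OF v] by (auto dest: INFM_EX)
    show ?thesis
      using game_fired_nonneg[of i] game_lower_bound[of "Suc i" _ v] i
      by (intro eventually_sequentiallyI[of "Suc i"]) fastforce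
  qed
  then have "\<forall>\<^sub>F n in sequentially. \<forall>v\<in>verts G. f n v \<ge> 0"
    by (intro eventually_ball_finite) auto
  then show ?thesis by (auto simp: eventually_sequentially)
qed

end

text \<open>
  Legality alone guarantees only that debts do not grow. That they are all paid off uses strong
  connectivity, through the fact that every vertex fires at some point.
\<close>

lemma non_terminating_nonneg_representative:
  assumes "non_terminating G x" "x \<in> chip_distributions G"
  obtains x' where "x' \<in> chip_distributions G" "x' \<ge> 0" "non_terminating G x'"
    "chip_degree G x' = chip_degree G x"
proof -
  obtain f where f: "infinite_legal_game G f" "f 0 = x"
    using assms(1) by (auto simp: non_terminating_iff terminating_def)
  then obtain s where s: "\<And>i. active G (f i) (s i)" "\<And>i. f (Suc i) = fire G (s i) (f i)"
    unfolding infinite_legal_game_def legal_firing_def by metis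
  obtain n where n: "\<forall>v\<in>verts G. f n v \<ge> 0" using game_eventually_nonneg[of f s, OF s] by blast
  have chip: "f i \<in> chip_distributions G" for i
  proof (induction i)
    case (Suc i)
    then show ?case using s(1)[of i] by (simp add: s(2) active_def chip_distributions_fire)
  qed (simp add: f assms)
  have "0 \<le> f n v" for v
    using n chip[of n] by (cases "v \<in> verts G") (auto simp: chip_distributions_def)
  then have "0 \<le> f n" by (simp add: le_fun_def)
  moreover have "non_terminating G (f n)"
    using infinite_legal_game_not_terminating[OF f(1)] by (simp add: non_terminating_iff)
  moreover have "chip_degree G (f n) = chip_degree G x"
    using game_degree[of f s, OF s] f(2) by simp
  ultimately show ?thesis using that chip by blast
qed

lemma non_terminating_degree_nonneg:
  assumes "non_terminating G x" "x \<in> chip_distributions G"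
  shows "chip_degree G x \<ge> 0"
  using non_terminating_nonneg_representative[OF assms] chip_degree_nonneg by metis


section \<open>Distance and minimally non-terminating distributions\<close>

lemma minimally_non_terminating_below:
  assumes "non_terminating G x" "x \<in> chip_distributions G"
  obtains z where "z \<in> chip_distributions G" "minimally_non_terminating G z" "z \<le> x"
  using assms
proof (induction "nat (chip_degree G x)" arbitrary: x thesis rule: less_induct)
  case less
  show ?case
  proof (cases "minimally_non_terminating G x")
    case True
    then show ?thesis using less.prems by blast
  next
    case False
    then obtain v where v: "v \<in> verts G" "non_terminating G (x - indicator {v})"
      using less.prems(2) by (auto simp: minimally_non_terminating_def non_terminating_iff)
    have chip: "x - indicator {v} \<in> chip_distributions G"
      using less.prems(3) v(1) by (intro chip_distributions_closed)
    have deg: "chip_degree G (x - indicator {v}) = chip_degree G x - 1"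
      using v(1) by (simp add: chip_degree_diff chip_degree_indicator)
    have le: "x - indicator {v} \<le> x" by (simp add: le_fun_def)
    have "nat (chip_degree G (x - indicator {v})) < nat (chip_degree G x)"
      using non_terminating_degree_nonneg[OF v(2) chip] deg by linarith
    then show ?thesis
      using less.hyps[OF _ _ v(2) chip] less.prems(1) le order_trans by metis
  qed
qed

text \<open>
  The distance is a least element over the integers, so its meaning depends on two facts: some
  \<open>y\<close> is admissible (a large pile on any one vertex), and admissible degrees are bounded below
  by 0.
\<close>

lemma nonterm_dist_witness:
  assumes "x \<in> chip_distributions G"
  obtains y where "y \<in> chip_distributions G" "y \<ge> 0" "non_terminating G (x + y)"
    "chip_degree G y = nonterm_dist G x"
    "\<And>y'. y' \<in> chip_distributions G \<Longrightarrow> y' \<ge> 0 \<Longrightarrow> non_terminating G (x + y') \<Longrightarrow>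
      nonterm_dist G x \<le> chip_degree G y'"
proof -
  let ?P = "\<lambda>y. y \<in> chip_distributions G \<and> y \<ge> 0 \<and> non_terminating G (x + y)"
  let ?k = "\<Sum>v\<in>verts G. int (out_degree G v)"
  obtain r where r: "r \<in> verts G" using strongly_connected by (auto simp: strongly_connected_def)
  define y0 where "y0 = (\<lambda>v. if v = r then max 0 (?k - chip_degree G x) else 0)"
  have "chip_degree G y0 = max 0 (?k - chip_degree G x)"
    using r by (simp add: chip_degree_def y0_def)
  then have "?P y0" using r
    by (auto simp: y0_def chip_distributions_def le_fun_def chip_degree_add
      intro!: non_terminating_of_large_degree)
  then obtain y where y: "?P y" "\<And>y'. ?P y' \<Longrightarrow> nat (chip_degree G y) \<le> nat (chip_degree G y')"
    using ex_has_least_nat[of ?P y0 "\<lambda>y. nat (chip_degree G y)"] by blast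
  have least: "chip_degree G y \<le> chip_degree G y'" if "?P y'" for y'
    using y(2)[OF that] that chip_degree_nonneg[of y'] by linarith
  have "nonterm_dist G x = chip_degree G y"
    unfolding nonterm_dist_def by (rule Least_equality) (use y(1) least in auto)
  then show ?thesis using that[of y] y(1) least by auto
qed

lemma nonterm_dist_le:
  assumes "x \<in> chip_distributions G" "y \<in> chip_distributions G" "y \<ge> 0" "non_terminating G (x + y)"
  shows "nonterm_dist G x \<le> chip_degree G y"
  using nonterm_dist_witness[OF assms(1)] assms by metis

lemma nonterm_dist_nonneg: "x \<in> chip_distributions G \<Longrightarrow> nonterm_dist G x \<ge> 0"
  using nonterm_dist_witness[of x] chip_degree_nonneg by metis

lemma nonterm_dist_eq_0_iff:
  assumes "x \<in> chip_distributions G"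
  shows "nonterm_dist G x = 0 \<longleftrightarrow> non_terminating G x"
proof
  assume 0: "nonterm_dist G x = 0"
  obtain y where y: "y \<in> chip_distributions G" "y \<ge> 0" "non_terminating G (x + y)"
    "chip_degree G y = nonterm_dist G x" using nonterm_dist_witness[OF assms] by metis
  have "y v = 0" for v
  proof (cases "v \<in> verts G")
    case True
    have "(\<Sum>v\<in>verts G. y v) = 0" using y(4) 0 by (simp add: chip_degree_def)
    then show ?thesis using True y(2) by (subst (asm) sum_nonneg_eq_0_iff) (auto simp: le_fun_def)
  qed (use y(1) in \<open>simp add: chip_distributions_def\<close>)
  then have "y = 0" by auto
  then show "non_terminating G x" using y(3) by simp
next
  assume "non_terminating G x"
  then have "nonterm_dist G x \<le> 0"
    using nonterm_dist_le[OF assms, of 0] by (simp add: chip_distributions_zero chip_degree_def)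
  then show "nonterm_dist G x = 0" using nonterm_dist_nonneg[OF assms] by simp
qed

lemma nonterm_dist_decrease:
  assumes "x \<in> chip_distributions G" "nonterm_dist G x > 0"
  obtains v where "v \<in> verts G" "nonterm_dist G (x + indicator {v}) < nonterm_dist G x"
proof -
  obtain y where y: "y \<in> chip_distributions G" "y \<ge> 0" "non_terminating G (x + y)"
    "chip_degree G y = nonterm_dist G x" using nonterm_dist_witness[OF assms(1)] by metis
  obtain v where v: "v \<in> verts G" "y v > 0"
    using y(4) assms(2) sum_nonpos[of "verts G" y] by (fastforce simp: chip_degree_def not_le)
  have "0 \<le> y u" for u using y(2) by (simp add: le_fun_def)
  then have "y - indicator {v} \<ge> 0" using v(2) by (auto simp: le_fun_def indicator_def)
  then have "nonterm_dist G (x + indicator {v}) \<le> chip_degree G (y - indicator {v})"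
    using y(1,3) assms(1) v(1) by (intro nonterm_dist_le chip_distributions_closed) auto
  then show ?thesis using that v(1) y(4) by (simp add: chip_degree_diff chip_degree_indicator)
qed

lemma minimally_non_terminating_iff_dist:
  assumes "x \<in> chip_distributions G"
  shows "minimally_non_terminating G x \<longleftrightarrow>
    nonterm_dist G x = 0 \<and> (\<forall>v\<in>verts G. nonterm_dist G (x - indicator {v}) = 1)"
proof -
  have "terminating G (x - indicator {v}) \<longleftrightarrow> nonterm_dist G (x - indicator {v}) = 1"
    if x: "non_terminating G x" and v: "v \<in> verts G" for v
  proof -
    have chip: "x - indicator {v} \<in> chip_distributions G"
      using assms v by (intro chip_distributions_closed)
    have "nonterm_dist G (x - indicator {v}) \<le> chip_degree G (indicator {v})"
      using x chip v
      by (intro nonterm_dist_le chip_distributions_indicator) (auto simp: le_fun_def)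
    then show ?thesis
      using nonterm_dist_eq_0_iff[OF chip] nonterm_dist_nonneg[OF chip] v
      by (auto simp: non_terminating_iff chip_degree_indicator)
  qed
  then show ?thesis
    using nonterm_dist_eq_0_iff[OF assms] by (auto simp: minimally_non_terminating_def)
qed

lemma minimally_non_terminating_exists:
  obtains z where "z \<in> chip_distributions G" "minimally_non_terminating G z"
proof -
  obtain y where "y \<in> chip_distributions G" "non_terminating G (0 + y)"
    using nonterm_dist_witness[OF chip_distributions_zero] by metis
  then show ?thesis using minimally_non_terminating_below[of y] that by auto
qed

text \<open>
  An optimal \<open>y\<close> for the zero distribution lies above some minimally non-terminating one, so it has
  degree at least \<open>t\<close>; a nonnegative distribution reached from a minimally non-terminating one is
  admissible and has degree exactly \<open>t\<close>.
\<close>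

lemma constant_degree_eq_dist_zero:
  assumes t: "\<And>z. z \<in> chip_distributions G \<Longrightarrow> minimally_non_terminating G z \<Longrightarrow> chip_degree G z = t"
  shows "t = nonterm_dist G 0"
proof (rule antisym)
  obtain y where y: "y \<in> chip_distributions G" "non_terminating G (0 + y)"
    "chip_degree G y = nonterm_dist G 0"
    using nonterm_dist_witness[OF chip_distributions_zero] by metis
  obtain z where z: "z \<in> chip_distributions G" "minimally_non_terminating G z" "z \<le> y"
    using minimally_non_terminating_below[of y] y by auto
  have "chip_degree G z \<le> chip_degree G y"
    using z(3) by (auto simp: chip_degree_def le_fun_def intro: sum_mono)
  then show "t \<le> nonterm_dist G 0" using t[OF z(1,2)] y(3) by simp
  have "non_terminating G z" using z(2) by (simp add: minimally_non_terminating_def)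
  then obtain z' where "z' \<in> chip_distributions G" "z' \<ge> 0" "non_terminating G z'"
    "chip_degree G z' = chip_degree G z"
    using z(1) by (rule non_terminating_nonneg_representative)
  then show "nonterm_dist G 0 \<le> t"
    using nonterm_dist_le[OF chip_distributions_zero, of z'] t[OF z(1,2)] by simp
qed


section \<open>The Riemann--Roch formula\<close>

text \<open>
  Minimality is a statement about distances near \<open>x\<close> (lemma
  \<open>minimally_non_terminating_iff_dist\<close>), and the formula transports distances near \<open>x\<close> to distances
  near \<open>C - x\<close>: removing a chip on one side is adding it on the other.
\<close>

lemma riemann_roch_imp_reflection:
  assumes C: "C \<in> chip_distributions G" and rr: "riemann_roch_formula G C t"
    and x: "x \<in> chip_distributions G" "minimally_non_terminating G x"
  shows "chip_degree G x = t" and "minimally_non_terminating G (C - x)"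
proof -
  have formula: "nonterm_dist G (C - y) = nonterm_dist G y - t + chip_degree G y"
    if "y \<in> chip_distributions G" for y
    using rr that by (simp add: riemann_roch_formula_def algebra_simps)
  have chip: "C - x \<in> chip_distributions G"
    using C x(1) by (intro chip_distributions_closed)
  have x0: "nonterm_dist G x = 0"
    and x1: "\<And>v. v \<in> verts G \<Longrightarrow> nonterm_dist G (x - indicator {v}) = 1"
    using x minimally_non_terminating_iff_dist[of x] by auto
  have up: "nonterm_dist G (C - x + indicator {v}) = nonterm_dist G (C - x)" if "v \<in> verts G" for v
  proof -
    have eq: "C - x + indicator {v} = C - (x - indicator {v})" by simp
    have "nonterm_dist G (C - x + indicator {v})
        = nonterm_dist G (x - indicator {v}) - t + chip_degree G (x - indicator {v})"
      unfolding eq using that x(1) by (intro formula chip_distributions_closed)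
    then show ?thesis
      using formula[OF x(1)] that x0 x1
      by (simp add: chip_degree_diff chip_degree_indicator)
  qed
  have C0: "nonterm_dist G (C - x) = 0"
  proof (rule ccontr)
    assume "nonterm_dist G (C - x) \<noteq> 0"
    then have "nonterm_dist G (C - x) > 0" using nonterm_dist_nonneg[OF chip] by simp
    then show False using nonterm_dist_decrease[OF chip] up by (metis less_irrefl)
  qed
  then show deg: "chip_degree G x = t" using formula[OF x(1)] x0 by simp
  have "nonterm_dist G (C - x - indicator {v}) = 1" if v: "v \<in> verts G" for v
  proof -
    have "non_terminating G (x + indicator {v})"
      using x(2) by (intro non_terminating_add) (auto simp: minimally_non_terminating_def le_fun_def)
    moreover have xv: "x + indicator {v} \<in> chip_distributions G"
      using x(1) v by (intro chip_distributions_closed)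
    ultimately have "nonterm_dist G (x + indicator {v}) = 0" by (simp add: nonterm_dist_eq_0_iff)
    then show ?thesis
      using formula[OF xv] deg v by (simp add: diff_diff_add chip_degree_add chip_degree_indicator)
  qed
  then show "minimally_non_terminating G (C - x)"
    using C0 minimally_non_terminating_iff_dist[OF chip] by simp
qed

text \<open>
  An optimal \<open>y\<close> for \<open>x\<close> has an excess \<open>x + y - z\<close> over a minimally non-terminating \<open>z\<close>; the
  excess is admissible for \<open>C - x\<close>, because adding it gives \<open>(C - z) + y\<close>.
\<close>

lemma nonterm_dist_reflection_le:
  assumes C: "C \<in> chip_distributions G"
    and deg: "\<And>z. z \<in> chip_distributions G \<Longrightarrow> minimally_non_terminating G z \<Longrightarrow> chip_degree G z = k"
    and refl: "\<And>z. z \<in> chip_distributions G \<Longrightarrow> minimally_non_terminating G z \<Longrightarrow>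
      minimally_non_terminating G (C - z)"
    and x: "x \<in> chip_distributions G"
  shows "nonterm_dist G (C - x) \<le> nonterm_dist G x - k + chip_degree G x"
proof -
  obtain y where y: "y \<in> chip_distributions G" "y \<ge> 0" "non_terminating G (x + y)"
    "chip_degree G y = nonterm_dist G x" using nonterm_dist_witness[OF x] by metis
  obtain z where z: "z \<in> chip_distributions G" "minimally_non_terminating G z" "z \<le> x + y"
    using minimally_non_terminating_below[OF y(3)] x y(1) chip_distributions_add by blast
  let ?y' = "x + y - z"
  have "non_terminating G (C - z)"
    using refl[OF z(1,2)] by (simp add: minimally_non_terminating_def)
  then have "non_terminating G (C - z + y)" using y(2) by (rule non_terminating_add)
  moreover have "C - z + y = C - x + ?y'" by (simp add: algebra_simps)
  ultimately have "nonterm_dist G (C - x) \<le> chip_degree G ?y'"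
    using C x y(1) z(1,3)
    by (intro nonterm_dist_le chip_distributions_closed) (auto simp: le_fun_def)
  then show ?thesis using y(4) deg[OF z(1,2)] by (simp add: chip_degree_add chip_degree_diff)
qed

text \<open>
  Evaluating degrees on a pair \<open>z\<close>, \<open>C - z\<close> of minimally non-terminating distributions gives
  \<open>deg C = 2 * k\<close>, which makes the inequality above self-dual under \<open>x \<mapsto> C - x\<close>.
\<close>

lemma reflection_imp_riemann_roch:
  assumes C: "C \<in> chip_distributions G"
    and deg: "\<And>z. z \<in> chip_distributions G \<Longrightarrow> minimally_non_terminating G z \<Longrightarrow> chip_degree G z = k"
    and refl: "\<And>z. z \<in> chip_distributions G \<Longrightarrow> minimally_non_terminating G z \<Longrightarrow>
      minimally_non_terminating G (C - z)"
  shows "riemann_roch_formula G C k"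
  unfolding riemann_roch_formula_def
proof
  fix x assume x: "x \<in> chip_distributions G"
  obtain z where z: "z \<in> chip_distributions G" "minimally_non_terminating G z"
    using minimally_non_terminating_exists .
  have "chip_degree G C - chip_degree G z = k"
    using deg[of "C - z"] refl[OF z] C z(1) by (simp add: chip_distributions_closed chip_degree_diff)
  then have degC: "chip_degree G C = 2 * k" using deg[OF z] by simp
  have "nonterm_dist G (C - x) \<le> nonterm_dist G x - k + chip_degree G x"
    using C deg refl x by (rule nonterm_dist_reflection_le)
  moreover have "nonterm_dist G (C - (C - x)) \<le> nonterm_dist G (C - x) - k + chip_degree G (C - x)"
    using C deg refl chip_distributions_diff[OF C x] by (rule nonterm_dist_reflection_le)
  ultimately show "nonterm_dist G x - nonterm_dist G (C - x) = k - chip_degree G x"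
    using degC by (simp add: chip_degree_diff)
qed

end

theorem theorem5p3:
  fixes G :: "('a, 'b) pre_digraph"
  assumes "fin_digraph G" and "loopfree_digraph G" and "strongly_connected G"
  shows "(riemann_roch_property G \<longleftrightarrow>
      (\<forall>x\<in>chip_distributions G. minimally_non_terminating G x \<longrightarrow>
        chip_degree G x = nonterm_dist G 0) \<and>
      (\<exists>C\<in>chip_distributions G. \<forall>x\<in>chip_distributions G.
        minimally_non_terminating G x \<longrightarrow> minimally_non_terminating G (C - x)))
    \<and> (\<forall>C\<in>chip_distributions G.
      (\<forall>x\<in>chip_distributions G. minimally_non_terminating G x \<longrightarrow>
        chip_degree G x = nonterm_dist G 0) \<and>
      (\<forall>x\<in>chip_distributions G.
        minimally_non_terminating G x \<longrightarrow> minimally_non_terminating G (C - x))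
      \<longrightarrow> canonical_distribution G C)"
proof -
  interpret fin_digraph G by fact
  interpret loopfree_digraph G by fact
  interpret chip_firing_graph G by unfold_locales fact
  let ?deg = "\<forall>x\<in>chip_distributions G. minimally_non_terminating G x \<longrightarrow>
      chip_degree G x = nonterm_dist G 0"
  let ?refl = "\<lambda>C. \<forall>x\<in>chip_distributions G.
      minimally_non_terminating G x \<longrightarrow> minimally_non_terminating G (C - x)"
  have sufficient: "canonical_distribution G C"
    if "C \<in> chip_distributions G" "?deg" "?refl C" for C
    unfolding canonical_distribution_def
    using that reflection_imp_riemann_roch[of C "nonterm_dist G 0"] by blast
  have necessary: "?deg \<and> ?refl C" if "C \<in> chip_distributions G" "riemann_roch_formula G C t" for C t
  proof -
    note imp = riemann_roch_imp_reflection[OF that]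
    have "t = nonterm_dist G 0" by (rule constant_degree_eq_dist_zero) (rule imp(1))
    then show ?thesis using imp by blast
  qed
  have "riemann_roch_property G \<longleftrightarrow> ?deg \<and> (\<exists>C\<in>chip_distributions G. ?refl C)"
  proof
    assume "riemann_roch_property G"
    then obtain C t where "C \<in> chip_distributions G" "riemann_roch_formula G C t"
      by (auto simp: riemann_roch_property_def canonical_distribution_def)
    then show "?deg \<and> (\<exists>C\<in>chip_distributions G. ?refl C)" using necessary by blast
  next
    assume "?deg \<and> (\<exists>C\<in>chip_distributions G. ?refl C)"
    then show "riemann_roch_property G" using sufficient riemann_roch_property_def by blast
  qed
  then show ?thesis using sufficient by blast
qed

end
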